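(* Connectedness (the graph property consisting of all connected graphs on the vertex set $\mathbb{N}$) is elusive; that is, Seeker does not have a winning strategy in the associated transfinite game.
   Context: Let $[\mathbb{N}]^2=\{\{n,k\}: n,k\in\mathbb{N},\ n\neq k\}$. A graph on $\mathbb{N}$ is a subset $G\subseteq[\mathbb{N}]^2$, so the set of graphs is $2^{[\mathbb{N}]^2}$. A graph property is an isomorphism-invariant subset $\mathcal{S}\subseteq 2^{[\mathbb{N}]^2}$. The transfinite game for $\mathcal{S}$. Two players, Seeker and Hider, colour the edges of the complete graph on $\mathbb{N}$ with red, white, green. Initially all edges are white. In each turn Seeker picks a white edge and Hider recolours it green or red. Turns are numbered by ordinals and the play continues past limit ordinals (an edge coloured at an earlier turn keeps its colour, all other edges are white) as long as there are white edges. For an ordinal $\alpha$ let $R_\alpha,W_\alpha,G_\alpha$ be the sets of red, white and green edges after $\alpha$ turns and $\mathcal{P}_\alpha=\{G: G_\alpha\subseteq G\subseteq G_\alpha\cup W_\alpha\}$. Seeker wins if for some ordinal $\alpha$ reached in the play, $W_\alpha\neq\emptyset$ and either $\mathcal{P}_\alpha\subseteq\mathcal{S}$ or $\mathcal{P}_\alpha\subseteq 2^{[\mathbb{N}]^2}\setminus\mathcal{S}$; otherwise (all edges get coloured without this ever happening) Hider wins. The property $\mathcal{S}$ is elusive if Seeker does not have a winning strategy in this transfinite game. *)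

theory Defs
  imports Main
begin

type_synonym edge = "nat set"
type_synonym graph = "edge set"

definition all_edges :: "edge set" where
  "all_edges = {{n, k} | n k. n \<noteq> k}"

definition graph_property :: "graph set \<Rightarrow> bool" where
  "graph_property S \<longleftrightarrow>
     S \<subseteq> Pow all_edges \<and> (\<forall>\<pi>. bij \<pi> \<longrightarrow> (\<forall>G\<in>S. (\<lambda>e. \<pi> ` e) ` G \<in> S))"

text \<open>
  Every turn colours an edge that was white before, so the sequence of turns of a (partial) play,
  indexed by the ordinals below some \<open>\<alpha>\<close>, amounts to a well-order of type \<open>\<alpha>\<close> on the set of
  coloured edges (the order in which Seeker picked them) together with the set of those edges
  that Hider coloured green. The well-orders are reflexive, so their field is the set
  of coloured edges also when there are fewer than two of them. As the field is arbitrary, every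
  ordinal length that a play can have occurs.
\<close>

record history =
  turns :: "edge rel"
  green :: "edge set"

definition is_history :: "history \<Rightarrow> bool" where
  "is_history h \<longleftrightarrow>
     Well_order (turns h) \<and> Field (turns h) \<subseteq> all_edges \<and> green h \<subseteq> Field (turns h)"

definition red :: "history \<Rightarrow> edge set" where
  "red h = Field (turns h) - green h"

definition white :: "history \<Rightarrow> edge set" where
  "white h = all_edges - (green h \<union> red h)"

definition possible_graphs :: "history \<Rightarrow> graph set" where
  "possible_graphs h = {G. green h \<subseteq> G \<and> G \<subseteq> green h \<union> white h}"

definition restrict_history :: "history \<Rightarrow> edge set \<Rightarrow> history" where
  "restrict_history h A = \<lparr>turns = Restr (turns h) A, green = green h \<inter> A\<rparr>"

text \<open>
  The histories after \<open>\<beta>\<close> turns, for all ordinals \<open>\<beta>\<close> up to and including the length of the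
  given one, are its restrictions to initial segments.
\<close>

definition stages :: "history \<Rightarrow> history set" where
  "stages h = {restrict_history h A | A.
     A \<subseteq> Field (turns h) \<and> (\<forall>e\<in>A. under (turns h) e \<subseteq> A)}"

definition history_before :: "history \<Rightarrow> edge \<Rightarrow> history" where
  "history_before h e = restrict_history h (underS (turns h) e)"

definition complete_play :: "history \<Rightarrow> bool" where
  "complete_play h \<longleftrightarrow> is_history h \<and> white h = {}"

definition Seeker_wins :: "graph set \<Rightarrow> history \<Rightarrow> bool" where
  "Seeker_wins S h \<longleftrightarrow>
     (\<exists>p\<in>stages h. white p \<noteq> {} \<and>
        (possible_graphs p \<subseteq> S \<or> possible_graphs p \<subseteq> Pow all_edges - S))"

text \<open>A strategy may depend on the whole history, not only on the current colouring.\<close>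

definition Seeker_strategy :: "(history \<Rightarrow> edge) \<Rightarrow> bool" where
  "Seeker_strategy \<sigma> \<longleftrightarrow> (\<forall>h. is_history h \<and> white h \<noteq> {} \<longrightarrow> \<sigma> h \<in> white h)"

definition follows :: "(history \<Rightarrow> edge) \<Rightarrow> history \<Rightarrow> bool" where
  "follows \<sigma> h \<longleftrightarrow> (\<forall>e\<in>Field (turns h). e = \<sigma> (history_before h e))"

definition winning_Seeker_strategy :: "graph set \<Rightarrow> (history \<Rightarrow> edge) \<Rightarrow> bool" where
  "winning_Seeker_strategy S \<sigma> \<longleftrightarrow>
     Seeker_strategy \<sigma> \<and> (\<forall>h. complete_play h \<and> follows \<sigma> h \<longrightarrow> Seeker_wins S h)"

definition elusive :: "graph set \<Rightarrow> bool" where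
  "elusive S \<longleftrightarrow> \<not> (\<exists>\<sigma>. winning_Seeker_strategy S \<sigma>)"

definition adjacency :: "graph \<Rightarrow> nat rel" where
  "adjacency G = {(u, v). {u, v} \<in> G}"

definition connected_graph :: "graph \<Rightarrow> bool" where
  "connected_graph G \<longleftrightarrow> (\<forall>u v. (u, v) \<in> (adjacency G)\<^sup>*)"

definition connectedness :: "graph set" where
  "connectedness = {G. G \<subseteq> all_edges \<and> connected_graph G}"

lemma graph_property_connectedness: "graph_property connectedness"
proof -
  have "(\<lambda>e. \<pi> ` e) ` G \<in> connectedness" if \<pi>: "bij \<pi>" and G: "G \<in> connectedness" for \<pi> G
  proof -
    let ?H = "(\<lambda>e. \<pi> ` e) ` G"
    have "?H \<subseteq> all_edges"
    proof
      fix e assume "e \<in> ?H"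
      then obtain d where d: "d \<in> G" "e = \<pi> ` d" by blast
      with G obtain n k where "d = {n, k}" "n \<noteq> k"
        unfolding connectedness_def all_edges_def by blast
      with d \<pi> have "e = {\<pi> n, \<pi> k}" "\<pi> n \<noteq> \<pi> k"
        by (auto dest: bij_is_inj injD)
      then show "e \<in> all_edges" unfolding all_edges_def by blast
    qed
    moreover have path: "(\<pi> u, \<pi> v) \<in> (adjacency ?H)\<^sup>*" if "(u, v) \<in> (adjacency G)\<^sup>*" for u v
      using that
    proof induction
      case (step v w)
      then have "{v, w} \<in> G" by (simp add: adjacency_def)
      then have "\<pi> ` {v, w} \<in> ?H" by (rule imageI)
      then have "(\<pi> v, \<pi> w) \<in> adjacency ?H" by (simp add: adjacency_def)
      with step.IH show ?case by (rule rtrancl_into_rtrancl)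
    qed simp
    have "connected_graph ?H"
      unfolding connected_graph_def
    proof (intro allI)
      fix u v
      obtain u' v' where "u = \<pi> u'" "v = \<pi> v'" using \<pi> by (metis bij_pointE)
      with G show "(u, v) \<in> (adjacency ?H)\<^sup>*"
        using path by (simp add: connectedness_def connected_graph_def)
    qed
    ultimately show ?thesis by (simp add: connectedness_def)
  qed
  then show ?thesis
    unfolding graph_property_def by (auto simp: connectedness_def)
qed

end

theory Submission
  imports Defs
begin

text \<open>
  Group the edges by their larger endpoint: for each vertex \<open>n\<close> there are only finitely many edges
  \<open>{k, n}\<close> with \<open>k < n\<close>. Hider colours the edges of each group red, except the one that is coloured
  last in its group, which becomes green. Since the groups are finite, limit stages cannot exhaust a
  group without some turn having been the last one in it; this is why Hider survives limits, where
  the greedy replies of the finite game fail.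

  At every stage each vertex \<open>n > 0\<close> has a smaller neighbour in the graph of green and white edges:
  either its group still has a white edge, or the last edge of the group is green. Descending
  along such neighbours leads every vertex to \<open>0\<close>, so this graph is connected
  (\<open>connected_if_smaller_neighbour\<close>). On the other hand, each vertex has at most one smaller neighbour
  in the green graph, and as long as some edge is white, the larger endpoint \<open>n\<close> of that edge has
  none. So the green graph is a forest in which \<open>0\<close> and \<open>n\<close> are roots of different trees
  (\<open>not_connected_if_orphan\<close>). Both graphs are still possible, hence Seeker has not won
  (\<open>not_Seeker_wins_last_down\<close>).

  Finally, the transfinite play of a given Seeker strategy against this reply rule must be shown to
  exist. It is a maximal partial play for the initial segment order, by Zorn's lemma: unions of
  chains of partial plays are partial plays, and a partial play that leaves a white edge can be
  prolonged by the next pick of Seeker (\<open>ex_complete_play\<close>).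
\<close>

section \<open>Plays against a fixed reply rule\<close>

text \<open>
  A reply rule \<open>\<rho>\<close> decides from the set of edges coloured earlier and the picked edge whether the reply
  is green. Then the order of turns alone determines the history, so plays against a fixed rule can
  be constructed as well-orders.
\<close>

definition play_of :: "(edge set \<Rightarrow> edge \<Rightarrow> bool) \<Rightarrow> edge rel \<Rightarrow> history" where
  "play_of \<rho> r = \<lparr>turns = r, green = {e \<in> Field r. \<rho> (underS r e) e}\<rparr>"

lemma init_seg_of_underS:
  assumes "r initial_segment_of s" "Refl r" "e \<in> Field r"
  shows "underS s e = underS r e"
proof -
  have "(e, e) \<in> r" using assms by (simp add: refl_on_def)
  then show ?thesis using assms(1) by (auto simp: underS_def init_seg_of_def)
qed

text \<open>
  A turn keeps its past when the play is prolonged. Hence following a strategy is preserved both by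
  unions of chains and by one further turn.
\<close>

lemma init_seg_of_history_before:
  assumes rs: "r initial_segment_of s" and r: "Refl r" and e: "e \<in> Field r"
  shows "history_before (play_of \<rho> s) e = history_before (play_of \<rho> r) e"
proof -
  let ?A = "underS r e"
  have A: "?A \<subseteq> Field r" by (rule Order_Relation.underS_Field)
  have "Restr s ?A = Restr r ?A"
    using rs r A by (fastforce simp: init_seg_of_def refl_on_def)
  moreover have "Field r \<subseteq> Field s"
    using rs by (auto simp: init_seg_of_def intro!: mono_Field)
  ultimately show ?thesis
    using A init_seg_of_underS[OF rs r]
    by (auto simp: history_before_def restrict_history_def play_of_def e)
qed

text \<open>
  For chains under mere inclusion this fails; that later relations add elements only on top keeps
  infinite descending sequences out of the union.
\<close>

lemma Well_order_Union_init_seg: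
  assumes C: "C \<in> Chains init_seg_of" and wo: "\<And>r. r \<in> C \<Longrightarrow> Well_order r"
  shows "Well_order (\<Union>C)"
proof -
  have sub: "chain\<^sub>\<subseteq> C"
    using C by (auto simp: Chains_def chain_subset_def init_seg_of_def)
  have "wf (\<Union>{r - Id | r. r \<in> C})"
    using wf_Union_wf_init_segs[OF Chains_inits_DiffI[OF C]] wo
    by (auto simp: well_order_on_def)
  moreover have "\<Union>{r - Id | r. r \<in> C} = \<Union>C - Id" by blast
  moreover have "Refl (\<Union>C)"
    using wo by (fastforce simp: order_on_defs refl_on_def)
  moreover have "\<Union>C \<subseteq> Field (\<Union>C) \<times> Field (\<Union>C)" by (auto simp: Field_def)
  ultimately show ?thesis
    using wo chain_subset_trans_Union[OF sub] chain_subset_antisym_Union[OF sub]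
      chain_subset_Total_Union[OF sub]
    by (simp add: order_on_defs)
qed

definition add_top :: "'a rel \<Rightarrow> 'a \<Rightarrow> 'a rel" where
  "add_top r x = r \<union> insert x (Field r) \<times> {x}"

lemma Field_add_top: "Field (add_top r x) = insert x (Field r)"
  by (auto simp: add_top_def Field_def)

lemma Well_order_add_top:
  assumes r: "Well_order r" and x: "x \<notin> Field r"
  shows "Well_order (add_top r x)" (is "Well_order ?s")
proof -
  have "antisym r" and "trans r" using r by (simp_all add: order_on_defs)
  have "?s - Id = (r - Id) \<union> Field r \<times> {x}"
    using x by (auto simp: add_top_def Field_def)
  moreover have "wf ((r - Id) \<union> Field r \<times> {x})"
  proof (rule wf_Un)
    show "wf (r - Id)" using r by (simp add: well_order_on_def)
    show "wf (Field r \<times> {x})" using x unfolding wf_eq_minimal by (metis mem_Sigma_iff singletonD)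
    show "Domain (r - Id) \<inter> Range (Field r \<times> {x}) = {}" using x by (auto simp: Field_def)
  qed
  moreover have "?s \<subseteq> Field ?s \<times> Field ?s" by (auto simp: Field_def)
  moreover have "Refl ?s"
    using r unfolding refl_on_def Field_add_top by (auto simp: add_top_def order_on_defs refl_on_def)
  moreover have "Total ?s"
    using r unfolding total_on_def Field_add_top by (auto simp: add_top_def order_on_defs total_on_def)
  moreover have "trans ?s"
    using \<open>trans r\<close> x by (intro transI) (auto simp: add_top_def dest: transD FieldI1 FieldI2)
  moreover have "antisym ?s"
    using \<open>antisym r\<close> x by (intro antisymI) (auto simp: add_top_def dest: antisymD FieldI1 FieldI2)
  ultimately show ?thesis by (simp add: order_on_defs)
qed

lemma init_seg_of_add_top:
  "x \<notin> Field r \<Longrightarrow> r initial_segment_of (add_top r x)"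
  by (auto simp: add_top_def init_seg_of_def Field_def)

lemma history_before_add_top:
  assumes x: "x \<notin> Field r" and r: "Refl r"
  shows "history_before (play_of \<rho> (add_top r x)) x = play_of \<rho> r"
proof -
  let ?s = "add_top r x"
  have "underS ?s x = Field r" using x by (auto simp: add_top_def underS_def Field_def)
  moreover have "Restr ?s (Field r) = r" using x by (auto simp: add_top_def Field_def)
  moreover have "underS ?s e = underS r e" if "e \<in> Field r" for e
    by (rule init_seg_of_underS[OF init_seg_of_add_top[OF x] r that])
  then have "{e \<in> Field ?s. \<rho> (underS ?s e) e} \<inter> Field r = {e \<in> Field r. \<rho> (underS r e) e}"
    by (auto simp: Field_add_top)
  ultimately show ?thesis
    by (simp add: history_before_def restrict_history_def play_of_def)
qed

lemma white_play_of: "white (play_of \<rho> r) = all_edges - Field r"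
  by (auto simp: white_def red_def play_of_def)

lemma is_history_play_of:
  "Well_order r \<Longrightarrow> Field r \<subseteq> all_edges \<Longrightarrow> is_history (play_of \<rho> r)"
  by (auto simp: is_history_def play_of_def)

text \<open>
  Seeker's strategy is consulted only at partial plays with a white edge, where it names a legal
  turn. So nothing but the lack of white edges can stop a play.
\<close>

lemma ex_complete_play:
  assumes \<sigma>: "Seeker_strategy \<sigma>"
  shows "\<exists>r. complete_play (play_of \<rho> r) \<and> follows \<sigma> (play_of \<rho> r)"
proof -
  define L where
    "L = {r. Well_order r \<and> Field r \<subseteq> all_edges \<and> follows \<sigma> (play_of \<rho> r)}"
  have refl: "Refl r" if "r \<in> L" for r using that by (auto simp: L_def order_on_defs)
  let ?P = "\<lambda>r s :: edge rel. r initial_segment_of s"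
  have "\<exists>m\<in>L. \<forall>r\<in>L. ?P m r \<longrightarrow> r = m"
  proof (rule predicate_Zorn)
    show "partial_order_on L (relation_of ?P L)"
      by (rule partial_order_on_relation_ofI)
        (simp, erule (1) trans_init_seg_of, erule (1) antisym_init_seg_of)
  next
    fix C assume C: "C \<in> Chains (relation_of ?P L)"
    then have CL: "C \<subseteq> L" and Ci: "C \<in> Chains init_seg_of"
      by (auto simp: Chains_def relation_of_def)
    have seg: "r initial_segment_of \<Union>C" if "r \<in> C" for r
      by (rule Chains_init_seg_of_Union[OF Ci that])
    have "Well_order (\<Union>C)"
      using Ci CL by (intro Well_order_Union_init_seg) (auto simp: L_def)
    moreover have "Field (\<Union>C) \<subseteq> all_edges"
      using CL by (auto simp: L_def)
    moreover have "follows \<sigma> (play_of \<rho> (\<Union>C))"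
      unfolding follows_def
    proof
      fix e assume "e \<in> Field (turns (play_of \<rho> (\<Union>C)))"
      then obtain r where r: "r \<in> C" "e \<in> Field r" by (auto simp: play_of_def)
      then have "e = \<sigma> (history_before (play_of \<rho> r) e)"
        using CL by (auto simp: L_def follows_def play_of_def)
      then show "e = \<sigma> (history_before (play_of \<rho> (\<Union>C)) e)"
        using init_seg_of_history_before[OF seg refl] r CL by auto
    qed
    ultimately show "\<exists>u\<in>L. \<forall>r\<in>C. r initial_segment_of u"
      using seg unfolding L_def by blast
  qed
  then obtain m where m: "m \<in> L" and max: "\<And>r. r \<in> L \<Longrightarrow> ?P m r \<Longrightarrow> r = m" by blast
  have wo: "Well_order m" and Fm: "Field m \<subseteq> all_edges" and fol: "follows \<sigma> (play_of \<rho> m)"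
    using m by (auto simp: L_def)
  have "white (play_of \<rho> m) = {}"
  proof (rule ccontr)
    assume "white (play_of \<rho> m) \<noteq> {}"
    define x where "x = \<sigma> (play_of \<rho> m)"
    have "x \<in> white (play_of \<rho> m)"
      using \<sigma> \<open>white _ \<noteq> {}\<close> is_history_play_of[OF wo Fm] by (simp add: Seeker_strategy_def x_def)
    then have x: "x \<notin> Field m" "x \<in> all_edges" by (auto simp: white_play_of)
    let ?s = "add_top m x"
    have seg: "?P m ?s" by (rule init_seg_of_add_top[OF x(1)])
    have "e = \<sigma> (history_before (play_of \<rho> ?s) e)" if "e \<in> insert x (Field m)" for e
    proof (cases "e = x")
      case True
      then show ?thesis using history_before_add_top[OF x(1) refl[OF m]] by (simp add: x_def)
    next
      case False
      then show ?thesis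
        using that fol init_seg_of_history_before[OF seg refl[OF m]]
        by (simp add: follows_def play_of_def)
    qed
    then have "follows \<sigma> (play_of \<rho> ?s)"
      unfolding follows_def by (simp add: play_of_def Field_add_top)
    then have "?s \<in> L"
      using Well_order_add_top[OF wo x(1)] Fm x(2) unfolding L_def
      by (simp add: Field_add_top)
    then have "?s = m" using seg by (rule max)
    then have "x \<in> Field m" using Field_add_top[of m x] by auto
    with x(1) show False by blast
  qed
  then show ?thesis
    using fol is_history_play_of[OF wo Fm] by (auto simp: complete_play_def)
qed

section \<open>Connectedness through smaller neighbours\<close>

lemma connected_if_smaller_neighbour:
  assumes "\<And>n. 0 < n \<Longrightarrow> \<exists>k<n. {k, n} \<in> G"
  shows "connected_graph G"
proof -
  have "sym (adjacency G)" by (auto simp: sym_def adjacency_def insert_commute)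
  then have sym: "sym ((adjacency G)\<^sup>*)" by (rule sym_rtrancl)
  have to0: "(n, 0) \<in> (adjacency G)\<^sup>*" for n
  proof (induction n rule: less_induct)
    case (less n)
    show ?case
    proof (cases "n = 0")
      case False
      then obtain k where k: "k < n" "{k, n} \<in> G" using assms by blast
      then have "(n, k) \<in> adjacency G" by (simp add: adjacency_def insert_commute)
      then show ?thesis using less.IH[OF k(1)] by (rule converse_rtrancl_into_rtrancl)
    qed simp
  qed
  then show ?thesis
    unfolding connected_graph_def using sym by (meson rtrancl_trans symD)
qed

text \<open>
  The vertices from which \<open>n\<close> is reached by passing to smaller neighbours form the component of \<open>n\<close>:
  a vertex that leads to \<open>n\<close> has no smaller neighbour other than the one on its way to \<open>n\<close>. As the way
  descends, it cannot start at \<open>0\<close>.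
\<close>

lemma not_connected_if_orphan:
  assumes G: "G \<subseteq> all_edges"
    and unique: "\<And>n k k'. k < n \<Longrightarrow> k' < n \<Longrightarrow> {k, n} \<in> G \<Longrightarrow> {k', n} \<in> G \<Longrightarrow> k = k'"
    and n: "0 < n" and orphan: "\<And>k. k < n \<Longrightarrow> {k, n} \<notin> G"
  shows "\<not> connected_graph G"
proof
  assume "connected_graph G"
  \<comment> \<open>the step from a vertex to a smaller neighbour\<close>
  define P where "P = {(v, k). k < v \<and> {k, v} \<in> G}"
  have "(n, 0) \<in> (adjacency G)\<^sup>*"
    using \<open>connected_graph G\<close> by (simp add: connected_graph_def)
  then have "(0, n) \<in> P\<^sup>*"
  proof induction
    case (step v w)
    then have vw: "{v, w} \<in> G" by (simp add: adjacency_def)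
    then have "v \<noteq> w" using G by (auto simp: all_edges_def doubleton_eq_iff)
    then consider "v < w" | "w < v" by linarith
    then show ?case
    proof cases
      case 1
      then have "(w, v) \<in> P" using vw by (simp add: P_def)
      then show ?thesis using step.IH by (rule converse_rtrancl_into_rtrancl)
    next
      case 2
      then have w: "{w, v} \<in> G" using vw by (simp add: insert_commute)
      with 2 orphan have "v \<noteq> n" by blast
      with step.IH obtain u where "(v, u) \<in> P" "(u, n) \<in> P\<^sup>*"
        by (meson converse_rtranclE)
      then show ?thesis using unique[of u v w] 2 w by (simp add: P_def)
    qed
  qed simp
  then show False using n by (auto simp: P_def elim: converse_rtranclE)
qed

section \<open>Hider's winning reply rule\<close>

definition down_edges :: "nat \<Rightarrow> edge set" where
  "down_edges n = (\<lambda>k. {k, n}) ` {..<n}"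

text \<open>
  The larger endpoint \<open>Max e\<close> names the group of \<open>e\<close>; the rule replies green when the rest of the
  group has been coloured.
\<close>

definition last_down :: "edge set \<Rightarrow> edge \<Rightarrow> bool" where
  "last_down A e \<longleftrightarrow> down_edges (Max e) - {e} \<subseteq> A"

lemma last_down_iff: "k < n \<Longrightarrow> last_down A {k, n} \<longleftrightarrow> down_edges n - {{k, n}} \<subseteq> A"
  by (simp add: last_down_def max_def)

lemma down_edges_subset: "down_edges n \<subseteq> all_edges"
  by (auto simp: down_edges_def all_edges_def)

lemma all_edges_cases:
  assumes "e \<in> all_edges" obtains k n where "k < n" "e = {k, n}"
proof -
  from assms obtain i j where ij: "e = {i, j}" "i \<noteq> j" by (auto simp: all_edges_def)
  then consider "i < j" | "j < i" by linarith
  then show thesis using ij that by cases (auto simp: insert_commute)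
qed

lemma finite_Well_order_greatest:
  assumes r: "Well_order r" and "finite A" "A \<noteq> {}" "A \<subseteq> Field r"
  shows "\<exists>a\<in>A. \<forall>b\<in>A. (b, a) \<in> r"
  using assms(2-)
proof (induction rule: finite_ne_induct)
  case (singleton x)
  then show ?case using r by (auto simp: order_on_defs refl_on_def)
next
  case (insert x F)
  then obtain a where a: "a \<in> F" "\<forall>b\<in>F. (b, a) \<in> r" by auto
  have "(x, a) \<in> r \<or> (a, x) \<in> r"
    using r insert a by (auto simp: order_on_defs total_on_def)
  then show ?case
    using a r insert.prems by (auto simp: order_on_defs refl_on_def dest: transD)
qed

lemma not_Seeker_wins_last_down:
  assumes "complete_play (play_of last_down r)"
  shows "\<not> Seeker_wins connectedness (play_of last_down r)"
proof
  assume "Seeker_wins connectedness (play_of last_down r)"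
  then obtain p where stage: "p \<in> stages (play_of last_down r)" and W: "white p \<noteq> {}"
    and possible: "possible_graphs p \<subseteq> connectedness \<or> possible_graphs p \<subseteq> Pow all_edges - connectedness"
    unfolding Seeker_wins_def by blast
  have wo: "Well_order r" and "Field r \<subseteq> all_edges"
    using assms by (simp_all add: complete_play_def is_history_def play_of_def)
  then have Fr: "Field r = all_edges"
    using assms by (auto simp: complete_play_def white_play_of)
  from stage obtain A where
      A: "A \<subseteq> all_edges" "\<And>e. e \<in> A \<Longrightarrow> under r e \<subseteq> A"
    and p: "p = restrict_history (play_of last_down r) A"
    unfolding stages_def by (auto simp: play_of_def Fr)
  have refl: "Refl r" and anti: "antisym r" using wo by (auto simp: order_on_defs)
  have green: "green p = {e \<in> A. last_down (underS r e) e}"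
    using A Fr by (auto simp: p restrict_history_def play_of_def)
  have "Field (Restr r A) = A" by (rule Refl_Field_Restr2[OF refl]) (simp add: Fr A)
  then have white: "white p = all_edges - A"
    by (auto simp: p white_def red_def restrict_history_def play_of_def)
  have before: "d \<in> underS r {k, n}"
    if "{k, n} \<in> green p" "k < n" "d \<in> down_edges n" "d \<noteq> {k, n}" for d k n
    using that by (auto simp: green last_down_iff)

  have "connected_graph (green p \<union> white p)"
  proof (rule connected_if_smaller_neighbour)
    fix n :: nat assume n: "0 < n"
    show "\<exists>k<n. {k, n} \<in> green p \<union> white p"
    proof (cases "down_edges n \<subseteq> A")
      case True
      \<comment> \<open>the last turn in the finite group of \<open>n\<close> was answered green\<close>
      have "finite (down_edges n)" "down_edges n \<noteq> {}"
        using n by (auto simp: down_edges_def)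
      with finite_Well_order_greatest[OF wo] obtain e where
        e: "e \<in> down_edges n" "\<forall>d\<in>down_edges n. (d, e) \<in> r"
        using Fr down_edges_subset by metis
      then obtain k where k: "k < n" "e = {k, n}" by (auto simp: down_edges_def)
      have "down_edges n - {e} \<subseteq> underS r e" using e by (auto simp: underS_def)
      then show ?thesis using True k e(1) by (auto simp: green last_down_iff)
    next
      case False
      then show ?thesis using down_edges_subset[of n] by (auto simp: white down_edges_def)
    qed
  qed
  then have "green p \<union> white p \<in> connectedness"
    using A by (auto simp: connectedness_def green white)
  moreover have "green p \<union> white p \<in> possible_graphs p"
    by (auto simp: possible_graphs_def)

  moreover have "\<not> connected_graph (green p)"
  proof -
    \<comment> \<open>a white edge delays the green reply in its group, so its larger endpoint is an orphan\<close>
    obtain j n where jn: "j < n" "{j, n} \<notin> A"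
      using W white by (metis DiffE all_edges_cases ex_in_conv)
    show ?thesis
    proof (rule not_connected_if_orphan)
      show "green p \<subseteq> all_edges" using A by (auto simp: green)
      show "0 < n" using jn by simp
    next
      fix k assume k: "k < n"
      show "{k, n} \<notin> green p"
      proof
        assume g: "{k, n} \<in> green p"
        then have "{k, n} \<in> A" by (simp add: green)
        then have "{j, n} \<noteq> {k, n}" using jn by metis
        then have "{j, n} \<in> underS r {k, n}"
          using before[OF g k] jn by (simp add: down_edges_def)
        then show False
          using A(2)[OF \<open>{k, n} \<in> A\<close>] jn by (auto simp: underS_def under_def)
      qed
    next
      fix m k k' assume m: "k < m" "k' < m" and g: "{k, m} \<in> green p" "{k', m} \<in> green p"
      \<comment> \<open>two green edges of one group would each have been coloured after the other\<close>
      show "k = k'"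
      proof (rule ccontr)
        assume "k \<noteq> k'"
        then have neq: "{k, m} \<noteq> {k', m}" by (auto simp: doubleton_eq_iff)
        then have "{k', m} \<in> underS r {k, m}" "{k, m} \<in> underS r {k', m}"
          using before[OF g(1) m(1)] before[OF g(2) m(2)] m by (auto simp: down_edges_def)
        then show False using anti neq by (auto simp: underS_def dest: antisymD)
      qed
    qed
  qed
  then have "green p \<notin> connectedness" by (simp add: connectedness_def)
  moreover have "green p \<in> possible_graphs p" by (auto simp: possible_graphs_def)
  ultimately show False using possible by blast
qed

theorem mainTheorem3:
  shows "elusive connectedness"
  using ex_complete_play not_Seeker_wins_last_down
  unfolding elusive_def winning_Seeker_strategy_def by blast

end
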